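(* For every integer $n\ge 1$, Houghton's group $\mathcal{H}_n$ has the $R_\infty$ property; that is, for every automorphism $\varphi:\mathcal{H}_n\to\mathcal{H}_n$ the Reidemeister number $R(\varphi)$ is infinite.
   Context: Let $\mathbb{N}=\{1,2,3,\dots\}$. For $n\ge 1$ let $X_n=\{1,\dots,n\}\times\mathbb{N}$, the disjoint union of $n$ rays $R_k=\{k\}\times\mathbb{N}$, $1\le k\le n$. Bijections act on the right, and $gh$ means $g$ followed by $h$. A bijection $g:X_n\to X_n$ is an eventual translation if there exist $(m_1,\dots,m_n)\in\mathbb{Z}^n$ and a finite set $K_g\subset X_n$ such that $(k,p)\cdot g=(k,p+m_k)$ for all $(k,p)\in X_n\setminus K_g$. Houghton's group $\mathcal{H}_n$ is the group of all eventual translations of $X_n$. For a group $G$ and an endomorphism $\varphi:G\to G$, define the equivalence relation $a\sim b$ if and only if $b=ha\varphi(h)^{-1}$ for some $h\in G$. The equivalence classes are called twisted conjugacy classes (Reidemeister classes) of $\varphi$, and the Reidemeister number $R(\varphi)$ is the cardinality of the set of these classes; we write $R(\varphi)=\infty$ if this set is infinite. $G$ has the $R_\infty$ property if $R(\varphi)=\infty$ for every automorphism $\varphi$ of $G$. *)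

theory Defs
  imports "HOL-Algebra.Bij" "HOL-Library.Extended_Nat"
begin

section \<open>Houghton's groups\<close>

definition rays :: "nat \<Rightarrow> (nat \<times> nat) set" where
  "rays n = {1..n} \<times> {1..}"

text \<open>The second coordinate is compared in \<open>int\<close>, so that a negative translation is not truncated.
  Only the values of \<open>m\<close> on \<open>{1..n}\<close> matter.\<close>

definition eventual_translation :: "nat \<Rightarrow> (nat \<times> nat \<Rightarrow> nat \<times> nat) \<Rightarrow> bool" where
  "eventual_translation n g \<longleftrightarrow>
     bij_betw g (rays n) (rays n) \<and>
     (\<exists>(m :: nat \<Rightarrow> int) K. finite K \<and> K \<subseteq> rays n \<and>
        (\<forall>(k, p) \<in> rays n - K. fst (g (k, p)) = k \<and> int (snd (g (k, p))) = int p + m k))"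

text \<open>As for \<^const>\<open>BijGroup\<close>, the elements are extensional, so that each bijection of the set
  is represented once. Bijections act on the right, hence the product of \<open>g\<close> and \<open>h\<close> is
  \<open>g\<close> followed by \<open>h\<close>; this is the opposite of the product of \<^const>\<open>BijGroup\<close>.\<close>

definition houghton_group :: "nat \<Rightarrow> (nat \<times> nat \<Rightarrow> nat \<times> nat) monoid" where
  "houghton_group n =
     \<lparr>carrier = {g \<in> extensional (rays n). eventual_translation n g},
      mult = (\<lambda>g h. compose (rays n) h g),
      one = (\<lambda>x \<in> rays n. x)\<rparr>"

lemma eventual_translation_id: "eventual_translation n (\<lambda>x \<in> rays n. x)"
  unfolding eventual_translation_def
proof (intro conjI exI[of _ "\<lambda>_. 0"] exI[of _ "{}"])
  show "bij_betw (\<lambda>x \<in> rays n. x) (rays n) (rays n)"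
    by (auto simp: bij_betw_def inj_on_def)
qed auto

lemma eventual_translation_compose:
  assumes "eventual_translation n g" "eventual_translation n h"
  shows "eventual_translation n (compose (rays n) h g)"
proof -
  from assms(1) obtain a K where bg: "bij_betw g (rays n) (rays n)" and K: "finite K" "K \<subseteq> rays n"
    and g: "\<And>k p. (k, p) \<in> rays n - K \<Longrightarrow> fst (g (k, p)) = k \<and> int (snd (g (k, p))) = int p + a k"
    unfolding eventual_translation_def by blast
  from assms(2) obtain b L where bh: "bij_betw h (rays n) (rays n)" and L: "finite L" "L \<subseteq> rays n"
    and h: "\<And>k p. (k, p) \<in> rays n - L \<Longrightarrow> fst (h (k, p)) = k \<and> int (snd (h (k, p))) = int p + b k"
    unfolding eventual_translation_def by blast
  let ?M = "K \<union> (g -` L \<inter> rays n)"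
  have "finite (g -` L \<inter> rays n)"
    by (rule finite_vimage_IntI[OF L(1) bij_betw_imp_inj_on[OF bg]])
  moreover have "fst (compose (rays n) h g (k, p)) = k \<and>
      int (snd (compose (rays n) h g (k, p))) = int p + (a k + b k)"
    if x: "(k, p) \<in> rays n - ?M" for k p
  proof -
    obtain k' p' where y: "g (k, p) = (k', p')" by fastforce
    have "g (k, p) \<in> rays n - L" using x bij_betw_apply[OF bg] by auto
    with h[of k' p'] g[of k p] x y show ?thesis by (auto simp: compose_def)
  qed
  ultimately show ?thesis
    unfolding eventual_translation_def
    using K bij_betw_compose[OF bg bh]
    by (intro conjI exI[of _ "\<lambda>k. a k + b k"] exI[of _ ?M]) auto
qed

lemma eventual_translation_inv:
  assumes "eventual_translation n g"
  shows "eventual_translation n (\<lambda>x \<in> rays n. inv_into (rays n) g x)"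
proof -
  from assms obtain a K where bg: "bij_betw g (rays n) (rays n)" and K: "finite K" "K \<subseteq> rays n"
    and g: "\<And>k p. (k, p) \<in> rays n - K \<Longrightarrow> fst (g (k, p)) = k \<and> int (snd (g (k, p))) = int p + a k"
    unfolding eventual_translation_def by blast
  let ?f = "\<lambda>x \<in> rays n. inv_into (rays n) g x"
  have "bij_betw ?f (rays n) (rays n)"
    using bij_betw_inv_into[OF bg] by simp
  moreover have "g ` K \<subseteq> rays n"
    using K(2) bij_betw_imp_surj_on[OF bg] by blast
  moreover have "fst (?f (k, p)) = k \<and> int (snd (?f (k, p))) = int p + - a k"
    if x: "(k, p) \<in> rays n - g ` K" for k p
  proof -
    obtain k' p' where y: "inv_into (rays n) g (k, p) = (k', p')" by fastforce
    have "(k', p') \<in> rays n" "g (k', p') = (k, p)"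
      using x y bij_betw_inv_into_right[OF bg, of "(k, p)"]
        bij_betw_apply[OF bij_betw_inv_into[OF bg], of "(k, p)"] by auto
    moreover from this have "(k', p') \<notin> K" using x by force
    ultimately show ?thesis using g[of k' p'] x y by auto
  qed
  ultimately show ?thesis
    unfolding eventual_translation_def using K(1)
    by (intro conjI exI[of _ "\<lambda>k. - a k"] exI[of _ "g ` K"]) auto
qed

lemma group_houghton_group: "group (houghton_group n)"
proof (rule groupI)
  fix x y assume "x \<in> carrier (houghton_group n)" "y \<in> carrier (houghton_group n)"
  then show "x \<otimes>\<^bsub>houghton_group n\<^esub> y \<in> carrier (houghton_group n)"
    by (simp add: houghton_group_def eventual_translation_compose)
next
  show "\<one>\<^bsub>houghton_group n\<^esub> \<in> carrier (houghton_group n)"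
    by (simp add: houghton_group_def eventual_translation_id)
next
  fix x y z
  assume "x \<in> carrier (houghton_group n)" "y \<in> carrier (houghton_group n)"
  then have "x \<in> rays n \<rightarrow> rays n"
    by (auto simp: houghton_group_def eventual_translation_def bij_betw_def)
  then show "x \<otimes>\<^bsub>houghton_group n\<^esub> y \<otimes>\<^bsub>houghton_group n\<^esub> z =
      x \<otimes>\<^bsub>houghton_group n\<^esub> (y \<otimes>\<^bsub>houghton_group n\<^esub> z)"
    by (auto simp: houghton_group_def compose_def fun_eq_iff Pi_iff)
next
  fix x assume "x \<in> carrier (houghton_group n)"
  then have x: "x \<in> extensional (rays n)" "x \<in> rays n \<rightarrow> rays n"
      "eventual_translation n x" "bij_betw x (rays n) (rays n)"
    by (auto simp: houghton_group_def eventual_translation_def bij_betw_def)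
  show "\<one>\<^bsub>houghton_group n\<^esub> \<otimes>\<^bsub>houghton_group n\<^esub> x = x"
    using x by (auto simp: houghton_group_def compose_def fun_eq_iff extensional_def)
  let ?y = "\<lambda>z \<in> rays n. inv_into (rays n) x z"
  have "?y \<in> carrier (houghton_group n)"
    using eventual_translation_inv[OF x(3)] by (simp add: houghton_group_def)
  moreover have "compose (rays n) x ?y = (\<lambda>z \<in> rays n. z)"
    using bij_betw_inv_into_right[OF x(4)] by (auto simp: compose_def fun_eq_iff)
  ultimately show "\<exists>y \<in> carrier (houghton_group n).
      y \<otimes>\<^bsub>houghton_group n\<^esub> x = \<one>\<^bsub>houghton_group n\<^esub>"
    by (intro bexI[of _ ?y]) (simp_all add: houghton_group_def)
qed


section \<open>Twisted conjugacy\<close>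

definition twisted_conj :: "('a, 'b) monoid_scheme \<Rightarrow> ('a \<Rightarrow> 'a) \<Rightarrow> ('a \<times> 'a) set" where
  "twisted_conj G \<phi> =
     {(a, b). a \<in> carrier G \<and> b \<in> carrier G \<and>
        (\<exists>h \<in> carrier G. b = h \<otimes>\<^bsub>G\<^esub> a \<otimes>\<^bsub>G\<^esub> inv\<^bsub>G\<^esub> (\<phi> h))}"

lemma equiv_twisted_conj:
  assumes "group G" "\<phi> \<in> hom G G"
  shows "equiv (carrier G) (twisted_conj G \<phi>)"
proof -
  interpret group_hom G G \<phi>
    using assms by (simp add: group_hom_def group_hom_axioms_def)
  show ?thesis
  proof (rule equivI)
    show "refl_on (carrier G) (twisted_conj G \<phi>)"
      by (auto simp: refl_on_def twisted_conj_def intro!: bexI[of _ "\<one>\<^bsub>G\<^esub>"])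
    show "sym (twisted_conj G \<phi>)"
    proof (rule symI)
      fix a b assume "(a, b) \<in> twisted_conj G \<phi>"
      then obtain h where *: "a \<in> carrier G" "b \<in> carrier G" "h \<in> carrier G"
        and b: "b = h \<otimes>\<^bsub>G\<^esub> a \<otimes>\<^bsub>G\<^esub> inv\<^bsub>G\<^esub> (\<phi> h)" by (auto simp: twisted_conj_def)
      have "a = inv\<^bsub>G\<^esub> h \<otimes>\<^bsub>G\<^esub> b \<otimes>\<^bsub>G\<^esub> inv\<^bsub>G\<^esub> (\<phi> (inv\<^bsub>G\<^esub> h))"
        using * by (simp add: b m_assoc) (simp add: m_assoc[symmetric])
      with * show "(b, a) \<in> twisted_conj G \<phi>"
        by (auto simp: twisted_conj_def intro!: bexI[of _ "inv\<^bsub>G\<^esub> h"])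
    qed
    show "trans (twisted_conj G \<phi>)"
    proof (rule transI)
      fix a b c assume "(a, b) \<in> twisted_conj G \<phi>" "(b, c) \<in> twisted_conj G \<phi>"
      then obtain h k where *: "a \<in> carrier G" "b \<in> carrier G" "c \<in> carrier G"
          "h \<in> carrier G" "k \<in> carrier G"
        and b: "b = h \<otimes>\<^bsub>G\<^esub> a \<otimes>\<^bsub>G\<^esub> inv\<^bsub>G\<^esub> (\<phi> h)"
        and c: "c = k \<otimes>\<^bsub>G\<^esub> b \<otimes>\<^bsub>G\<^esub> inv\<^bsub>G\<^esub> (\<phi> k)" by (auto simp: twisted_conj_def)
      have "c = (k \<otimes>\<^bsub>G\<^esub> h) \<otimes>\<^bsub>G\<^esub> a \<otimes>\<^bsub>G\<^esub> inv\<^bsub>G\<^esub> (\<phi> (k \<otimes>\<^bsub>G\<^esub> h))"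
        using * by (simp add: b c m_assoc inv_mult_group)
      with * show "(a, c) \<in> twisted_conj G \<phi>"
        by (auto simp: twisted_conj_def intro!: bexI[of _ "k \<otimes>\<^bsub>G\<^esub> h"])
    qed
  qed (auto simp: twisted_conj_def)
qed

definition reidemeister_classes :: "('a, 'b) monoid_scheme \<Rightarrow> ('a \<Rightarrow> 'a) \<Rightarrow> 'a set set" where
  "reidemeister_classes G \<phi> = carrier G // twisted_conj G \<phi>"

definition reidemeister_number :: "('a, 'b) monoid_scheme \<Rightarrow> ('a \<Rightarrow> 'a) \<Rightarrow> enat" where
  "reidemeister_number G \<phi> =
     (if finite (reidemeister_classes G \<phi>) then enat (card (reidemeister_classes G \<phi>)) else \<infinity>)"

definition R_infinity :: "('a, 'b) monoid_scheme \<Rightarrow> bool" where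
  "R_infinity G \<longleftrightarrow> (\<forall>\<phi> \<in> iso G G. reidemeister_number G \<phi> = \<infinity>)"

end

theory Submission
  imports Defs "HOL-Combinatorics.Permutations"
begin

text \<open>Write \<open>X\<close> for the union of the rays and \<open>H\<close> for Houghton's group, in which every finitary
  permutation of \<open>X\<close> lies. Every automorphism \<open>\<phi>\<close> of \<open>H\<close> is the conjugation by a permutation \<open>\<sigma>\<close>
  of \<open>X\<close> (\<open>phi_eq_conjugation\<close>): the transpositions are characterized in \<open>H\<close> as the involutions \<open>t\<close>
  such that the product of \<open>t\<close> with each of its conjugates has order at most 3, so \<open>\<phi>\<close> permutes
  them, and the way they overlap yields \<open>\<sigma>\<close>.

  Put \<open>f = \<sigma>\<^sup>-\<^sup>1\<close>. If \<open>a\<close> and \<open>b\<close> are twisted conjugate by \<open>\<phi>\<close>, then \<open>f \<circ> a\<close> and \<open>f \<circ> b\<close> are conjugate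
  under an element of \<open>H\<close>, so that this element carries the \<open>k\<close>-cycles of one to those of the other.
  Multiplication of \<open>f\<close> by finitary permutations creates arbitrarily many new \<open>k\<close>-cycles
  (\<open>ex_finitary_adding_cycles\<close>), provided that infinitely many points lie outside the \<open>k\<close>-cycles of \<open>f\<close>.
  Their number distinguishes infinitely many classes if it is an invariant
  (\<open>card_diff_image_eq\<close>), which is so if \<open>f\<close> has only finitely many \<open>k\<close>-cycles or if \<open>H\<close> consists of
  finitary permutations.

  The latter holds for \<open>n = 1\<close>. For \<open>n \<ge> 2\<close>, since \<open>f\<close> normalizes \<open>H\<close>, conjugating a shift along a
  ray by \<open>f\<close> shows that \<open>f\<close> eventually maps each ray monotonically into a ray
  (\<open>normalizer_eventually_monotone\<close>), and therefore that \<open>f\<close> has only finitely many cycles of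
  length \<open>n + 1\<close> (\<open>finite_exact_period_of_monotone\<close>).\<close>

section \<open>Finitary permutations and transpositions\<close>

text \<open>The inverse of a function, under a name that does not clash with the notation for inverses
  in the group theory of \<^theory>\<open>HOL-Algebra.Group\<close>.\<close>

abbreviation inv_fun :: "('a \<Rightarrow> 'b) \<Rightarrow> 'b \<Rightarrow> 'a" where
  "inv_fun \<equiv> inv_into UNIV"

lemma finite_inj_extends_to_finitary_permutation:
  assumes "finite F" "F \<subseteq> C" "q ` F \<subseteq> C" "inj_on q F"
  obtains p where "p permutes C" "finite {x. p x \<noteq> x}" "\<And>x. x \<in> F \<Longrightarrow> p x = q x"
proof -
  let ?B = "q ` F"
  have fB: "finite ?B" using assms by simp
  have "card ?B = card F" using assms by (simp add: card_image)
  then have "card (?B - F) = card (F - ?B)"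
    using assms(1) fB by (metis card_le_sym_Diff card_le_sym_Diff le_antisym order_refl)
  then obtain r where r: "bij_betw r (?B - F) (F - ?B)"
    using assms(1) fB by (metis finite_same_card_bij finite_Diff)
  define p where "p x = (if x \<in> F then q x else if x \<in> ?B then r x else x)" for x
  have "bij_betw p F ?B"
    using assms(4) by (auto simp: bij_betw_def inj_on_def p_def)
  moreover have "bij_betw p (?B - F) (F - ?B)"
    using r by (rule bij_betw_cong[THEN iffD1, rotated]) (auto simp: p_def)
  ultimately have "bij_betw p (F \<union> (?B - F)) (?B \<union> (F - ?B))"
    by (rule bij_betw_combine) auto
  then have "bij_betw p (F \<union> ?B) (F \<union> ?B)"
    by (simp add: Un_commute)
  then have "p permutes (F \<union> ?B)"
    by (rule bij_imp_permutes) (auto simp: p_def)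
  then have "p permutes C" 
    using assms(2,3) by (meson Un_least permutes_subset)
  moreover have "finite {x. p x \<noteq> x}"
    by (rule finite_subset[of _ "F \<union> ?B"]) (use assms fB in \<open>auto simp: p_def\<close>)
  ultimately show ?thesis using that by (simp add: p_def)
qed

lemma conj_transpose:
  assumes "bij g"
  shows "g \<circ> transpose a b \<circ> inv_fun g = transpose (g a) (g b)"
proof
  fix x
  obtain y where "x = g y" using assms by (metis bij_pointE)
  then show "(g \<circ> transpose a b \<circ> inv_fun g) x = transpose (g a) (g b) x"
    using assms by (auto simp: transpose_def bij_is_inj inj_eq)
qed

text \<open>This is what distinguishes the transpositions among the involutions: a conjugate of a
  transposition is again a transposition, and the product of two transpositions has order at most 3.\<close>

lemma transpose_comp_order:
  fixes a b c d :: 'a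
  defines "w \<equiv> transpose c d \<circ> transpose a b"
  shows "w \<circ> w = id \<or> w \<circ> w \<circ> w = id"
proof (cases "{a,b} \<inter> {c,d} = {} \<or> {a,b} = {c,d} \<or> a = b \<or> c = d")
  case True
  then have "w \<circ> w = id"
    by (auto simp: w_def fun_eq_iff transpose_def doubleton_eq_iff split: if_splits)
  then show ?thesis by simp
next
  case False
  then have "w \<circ> w \<circ> w = id"
    by (auto simp: w_def fun_eq_iff transpose_def doubleton_eq_iff split: if_splits)
  then show ?thesis by simp
qed

lemma transpose_commute_iff:
  assumes "a \<noteq> b" "c \<noteq> d"
  shows "transpose a b \<circ> transpose c d = transpose c d \<circ> transpose a b \<longleftrightarrow>
    {a, b} \<inter> {c, d} = {} \<or> {a, b} = {c, d}" (is "?L \<longleftrightarrow> ?R")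
proof
  assume ?R
  then show ?L
    by (auto simp: fun_eq_iff transpose_def doubleton_eq_iff split: if_splits)
next
  assume ?L
  then have *: "transpose a b (transpose c d x) = transpose c d (transpose a b x)" for x
    by (simp add: fun_eq_iff)
  from *[of a] *[of b] *[of c] *[of d] assms
  show ?R by (auto simp: transpose_def doubleton_eq_iff split: if_splits)
qed

lemma transpose_eq_iff_doubleton:
  assumes "a \<noteq> b" "c \<noteq> d"
  shows "transpose a b = transpose c d \<longleftrightarrow> {a, b} = {c, d}"
proof
  assume *: "transpose a b = transpose c d"
  from fun_cong[OF *, of a] fun_cong[OF *, of b] assms
  show "{a, b} = {c, d}" by (auto simp: transpose_def doubleton_eq_iff split: if_splits)
qed (auto simp: doubleton_eq_iff transpose_commute)

section \<open>Automorphisms of groups that contain all finitary permutations\<close>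

text \<open>The nontrivial transpositions of two points of \<open>X\<close>; \<^const>\<open>transpose\<close> itself allows equal
  points.\<close>

definition is_transposition_on :: "'a set \<Rightarrow> ('a \<Rightarrow> 'a) \<Rightarrow> bool" where
  "is_transposition_on X t \<longleftrightarrow> (\<exists>a b. a \<in> X \<and> b \<in> X \<and> a \<noteq> b \<and> t = transpose a b)"

text \<open>A group of permutations of an infinite set that contains all finitary permutations. It is
  given as a set of functions on the whole type, each of which fixes the complement of \<open>X\<close>.\<close>

locale finitary_overgroup =
  fixes X :: "'a set" and G :: "('a \<Rightarrow> 'a) set"
  assumes infinite: "infinite X"
    and permutes: "g \<in> G \<Longrightarrow> g permutes X"
    and comp_closed: "g \<in> G \<Longrightarrow> h \<in> G \<Longrightarrow> g \<circ> h \<in> G"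
    and inv_closed: "g \<in> G \<Longrightarrow> inv_fun g \<in> G"
    and finitary_mem: "p permutes X \<Longrightarrow> finite {x. p x \<noteq> x} \<Longrightarrow> p \<in> G"
begin

lemma bij: "g \<in> G \<Longrightarrow> bij g"
  using permutes permutes_bij by blast

lemma id_mem: "id \<in> G"
  by (rule finitary_mem) auto

lemma transpose_mem: "a \<in> X \<Longrightarrow> b \<in> X \<Longrightarrow> transpose a b \<in> G"
  by (rule finitary_mem[OF permutes_swap_id finite_subset[of _ "{a, b}"]])
    (auto simp: transpose_def)

lemma ex_fresh: "finite F \<Longrightarrow> \<exists>x \<in> X. x \<notin> F"
  using infinite by (meson finite_subset subsetI)

lemma conj_apply: "g \<in> G \<Longrightarrow> (g \<circ> t \<circ> inv_fun g) (g x) = g (t x)"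
  using bij by (simp add: bij_is_inj)

lemma ex_element_extending:
  assumes "finite F" "F \<subseteq> X" "q ` F \<subseteq> X" "inj_on q F"
  shows "\<exists>g \<in> G. \<forall>x \<in> F. g x = q x"
  using finite_inj_extends_to_finitary_permutation[OF assms] finitary_mem by metis

text \<open>A characterization of the transpositions in terms of the group alone, so that every
  automorphism permutes them.\<close>

lemma transposition_iff:
  assumes t: "t \<in> G"
  shows "is_transposition_on X t \<longleftrightarrow> t \<noteq> id \<and> t \<circ> t = id \<and>
    (\<forall>g \<in> G. let w = (g \<circ> t \<circ> inv_fun g) \<circ> t in w \<circ> w = id \<or> w \<circ> w \<circ> w = id)"
    (is "?L \<longleftrightarrow> ?R")
proof
  assume ?L
  then obtain a b where ab: "a \<in> X" "b \<in> X" "a \<noteq> b" "t = transpose a b"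
    by (auto simp: is_transposition_on_def)
  have "let w = (g \<circ> t \<circ> inv_fun g) \<circ> t in w \<circ> w = id \<or> w \<circ> w \<circ> w = id" if "g \<in> G" for g
    using transpose_comp_order[of "g a" "g b" a b] conj_transpose[OF bij[OF that], of a b]
    by (simp add: ab Let_def)
  then show ?R using ab by (simp add: transpose_eq_id_iff)
next
  assume R: ?R
  then have tt: "t (t x) = x" for x by (metis comp_apply id_apply)
  have tX: "t x \<in> X \<longleftrightarrow> x \<in> X" for x
    using permutes[OF t] by (simp add: permutes_in_image)
  have t_out: "t x = x" if "x \<notin> X" for x
    using permutes[OF t] that by (simp add: permutes_not_in)
  have no_long: False
    if "g \<in> G" "w = (g \<circ> t \<circ> inv_fun g) \<circ> t" "w a = c" "w c = e" "w e = d" "e \<noteq> a" "d \<noteq> a"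
    for g w a c d e
  proof -
    have "w (w a) = a \<or> w (w (w a)) = a" using R that(1,2) by (metis comp_apply id_apply)
    then show False using that by simp
  qed
  obtain a where a: "t a \<noteq> a" using R by (metis ext id_apply)
  define b where "b = t a"
  have b: "b \<noteq> a" "t b = a" "t a = b" using a tt by (simp_all add: b_def)
  have abX: "a \<in> X" "b \<in> X" using a b t_out tX by metis+
  have "t = transpose a b"
  proof (rule ccontr)
    assume "t \<noteq> transpose a b"
    then obtain c where c: "t c \<noteq> transpose a b c" by (metis ext)
    then have ca: "c \<noteq> a" using b(3) by (intro notI) simp
    moreover have cb: "c \<noteq> b" using c b(2) by (intro notI) simp
    ultimately have c': "c \<noteq> a" "c \<noteq> b" "t c \<noteq> c" using c by auto
    define d where "d = t c"
    have d: "t c = d" "t d = c" "d \<noteq> c" using tt c' by (simp_all add: d_def)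
    have d': "d \<noteq> a" "d \<noteq> b" using d b c' by metis+
    have cdX: "c \<in> X" "d \<in> X" using c' d t_out tX by metis+
    obtain e where e: "e \<in> X" "e \<notin> {a, b, c, d}" using ex_fresh[of "{a,b,c,d}"] by auto
    define f where "f = t e"
    have f: "t e = f" "t f = e" "f \<in> X" using tt e tX by (simp_all add: f_def)
    have f': "f \<notin> {a, b, c, d}" using f b d e by (metis insert_iff empty_iff)
    show False
    proof (cases "f = e")
      case True
      \<comment> \<open>\<open>t\<close> and its conjugate by a 5-cycle on \<open>a, b, c, d, e\<close> have a product that
        is a 5-cycle there.\<close>
      let ?q = "id(a := b, b := c, c := d, d := e)"
      have dist: "distinct [a, b, c, d, e]" using b(1) c'(1,2) d(3) d' e by auto
      then have "inj_on ?q {a, b, c, d}" by (simp add: inj_on_def) blast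
      moreover have "?q ` {a, b, c, d} \<subseteq> X" using dist abX cdX e by simp
      ultimately obtain g where g: "g \<in> G" and "\<forall>x \<in> {a, b, c, d}. g x = ?q x"
        using ex_element_extending[of "{a, b, c, d}" ?q] abX cdX by blast
      then have gv: "g a = b" "g b = c" "g c = d" "g d = e" using dist by simp_all
      define u where "u = g \<circ> t \<circ> inv_fun g"
      have u: "u (g x) = g (t x)" for x using conj_apply[OF g] by (simp add: u_def)
      have "u b = c" "u d = e" "u e = d" using u[of a] u[of c] u[of d] gv b(3) d(1,2) by simp_all
      then have w: "(u \<circ> t) a = c" "(u \<circ> t) c = e" "(u \<circ> t) e = d" using b(3) d(1) f(1) True by simp_all
      show False by (rule no_long[OF g _ w]) (use dist in \<open>auto simp: u_def\<close>)
    next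
      case False
      obtain h where h: "h \<in> X" "h \<notin> {a, b, c, d, e, f}" using ex_fresh[of "{a,b,c,d,e,f}"] by auto
      let ?q = "id(a := b, b := c, c := d, d := e, e := f, f := h)"
      \<comment> \<open>The product of \<open>t\<close> with its conjugate by a 7-cycle on \<open>a, b, c, d, e, f, h\<close>
        moves \<open>a\<close> to \<open>c\<close>, \<open>e\<close> and \<open>h\<close>.\<close>
      have dist: "distinct [a, b, c, d, e, f, h]"
        using b(1) c'(1,2) d(3) d' e f' False h by auto
      then have "inj_on ?q {a, b, c, d, e, f}" by (simp add: inj_on_def) blast
      moreover have "?q ` {a, b, c, d, e, f} \<subseteq> X" using dist abX cdX e f h by simp
      ultimately obtain g where g: "g \<in> G" and "\<forall>x \<in> {a, b, c, d, e, f}. g x = ?q x"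
        using ex_element_extending[of "{a, b, c, d, e, f}" ?q] abX cdX e f by blast
      then have gv: "g a = b" "g b = c" "g c = d" "g d = e" "g e = f" "g f = h"
        using dist by simp_all
      define u where "u = g \<circ> t \<circ> inv_fun g"
      have u: "u (g x) = g (t x)" for x using conj_apply[OF g] by (simp add: u_def)
      have "u b = c" "u d = e" "u f = h" using u[of a] u[of c] u[of e] gv b(3) d(1) f(1) by simp_all
      then have w: "(u \<circ> t) a = c" "(u \<circ> t) c = e" "(u \<circ> t) e = h" using b(3) d(1) f(1) by simp_all
      show False by (rule no_long[OF g _ w]) (use dist in \<open>auto simp: u_def\<close>)
    qed
  qed
  then show ?L using abX b by (auto simp: is_transposition_on_def)
qed

end

text \<open>An automorphism of such a group.\<close>

locale finitary_overgroup_auto = finitary_overgroup +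
  fixes \<phi> :: "('a \<Rightarrow> 'a) \<Rightarrow> 'a \<Rightarrow> 'a"
  assumes bij_phi: "bij_betw \<phi> G G"
    and phi_comp: "g \<in> G \<Longrightarrow> h \<in> G \<Longrightarrow> \<phi> (g \<circ> h) = \<phi> g \<circ> \<phi> h"
begin

lemma phi_mem: "g \<in> G \<Longrightarrow> \<phi> g \<in> G"
  using bij_phi bij_betwE by blast

lemma phi_eq_iff: "g \<in> G \<Longrightarrow> h \<in> G \<Longrightarrow> \<phi> g = \<phi> h \<longleftrightarrow> g = h"
  using bij_phi by (meson bij_betw_imp_inj_on inj_on_eq_iff)

lemma phi_surj: "g \<in> G \<Longrightarrow> \<exists>h \<in> G. \<phi> h = g"
  using bij_phi by (metis bij_betw_imp_surj_on imageE)

lemma phi_id: "\<phi> id = id"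
proof
  fix x
  have "\<phi> id (\<phi> id x) = \<phi> id x"
    using fun_cong[OF phi_comp[OF id_mem id_mem], of x] by simp
  then show "\<phi> id x = id x"
    using bij[OF phi_mem[OF id_mem]] by (simp add: bij_is_inj inj_eq)
qed

lemma phi_inv: assumes "g \<in> G" shows "\<phi> (inv_fun g) = inv_fun (\<phi> g)"
proof -
  have "\<phi> (inv_fun g) \<circ> \<phi> g = id"
    using phi_comp[OF inv_closed[OF assms] assms] bij[OF assms]
    by (simp add: phi_id bij_is_inj)
  then show ?thesis
    using bij[OF phi_mem[OF assms]]
    by (metis bij_is_surj comp_assoc comp_id id_comp surj_iff)
qed

lemma phi_eq_id_iff: "g \<in> G \<Longrightarrow> \<phi> g = id \<longleftrightarrow> g = id"
  using phi_eq_iff[OF _ id_mem] phi_id by simp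

lemma phi_transposition_iff:
  assumes t: "t \<in> G"
  shows "is_transposition_on X (\<phi> t) \<longleftrightarrow> is_transposition_on X t"
proof -
  define P where "P w \<longleftrightarrow> w \<circ> w = id \<or> w \<circ> w \<circ> w = id" for w :: "'a \<Rightarrow> 'a"
  have P: "P (\<phi> w) \<longleftrightarrow> P w" if "w \<in> G" for w
    using that comp_closed phi_comp phi_eq_id_iff unfolding P_def by metis
  have "P ((\<phi> g \<circ> \<phi> t \<circ> inv_fun (\<phi> g)) \<circ> \<phi> t) \<longleftrightarrow> P ((g \<circ> t \<circ> inv_fun g) \<circ> t)"
    if g: "g \<in> G" for g
  proof -
    have "\<phi> ((g \<circ> t \<circ> inv_fun g) \<circ> t) = (\<phi> g \<circ> \<phi> t \<circ> inv_fun (\<phi> g)) \<circ> \<phi> t"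
      using g t by (simp add: phi_comp comp_closed inv_closed phi_inv)
    then show ?thesis using P[of "(g \<circ> t \<circ> inv_fun g) \<circ> t"] g t
      by (simp add: comp_closed inv_closed)
  qed
  then have "(\<forall>g \<in> G. P ((g \<circ> \<phi> t \<circ> inv_fun g) \<circ> \<phi> t)) \<longleftrightarrow>
      (\<forall>g \<in> G. P ((g \<circ> t \<circ> inv_fun g) \<circ> t))"
    using phi_surj phi_mem by metis
  moreover have "\<phi> t \<circ> \<phi> t = id \<longleftrightarrow> t \<circ> t = id"
    using t phi_comp phi_eq_id_iff comp_closed by metis
  ultimately show ?thesis
    unfolding transposition_iff[OF t] transposition_iff[OF phi_mem[OF t]] Let_def P_def[symmetric]
    using phi_eq_id_iff[OF t] by simp
qed

lemma phi_transpose: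
  assumes "x \<in> X" "y \<in> X" "x \<noteq> y"
  obtains p q where "p \<in> X" "q \<in> X" "p \<noteq> q" "\<phi> (transpose x y) = transpose p q"
  using assms phi_transposition_iff[OF transpose_mem[OF assms(1,2)]]
  unfolding is_transposition_on_def by metis

text \<open>Transpositions that share exactly one point are those that are distinct and do not commute,
  so this relation is preserved.\<close>

lemma phi_transpose_overlap:
  assumes X: "x \<in> X" "y \<in> X" "z \<in> X" and ne: "x \<noteq> y" "x \<noteq> z" "y \<noteq> z"
    and p: "p \<noteq> q" "\<phi> (transpose x y) = transpose p q"
    and r: "r \<noteq> s" "\<phi> (transpose x z) = transpose r s"
  shows "{p, q} \<inter> {r, s} \<noteq> {}" "{p, q} \<noteq> {r, s}"
proof -
  note m = transpose_mem[OF X(1,2)] transpose_mem[OF X(1,3)]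
  have "transpose x y \<circ> transpose x z \<noteq> transpose x z \<circ> transpose x y"
    using transpose_commute_iff[of x y x z] ne by (auto simp: doubleton_eq_iff)
  then have "transpose p q \<circ> transpose r s \<noteq> transpose r s \<circ> transpose p q"
    using m phi_comp phi_eq_iff comp_closed p(2) r(2) by metis
  then show "{p, q} \<inter> {r, s} \<noteq> {}" "{p, q} \<noteq> {r, s}"
    using transpose_commute_iff p(1) r(1) by metis+
qed

lemma transpose_conj_star:
  assumes "y \<noteq> x" "z \<noteq> x" "y \<noteq> z"
  shows "transpose x y \<circ> transpose x z \<circ> transpose x y = transpose y z"
  using conj_transpose[of "transpose x y" x z] assms by simp

text \<open>The images of the transpositions that move a chosen point \<open>x0\<close> all move a common point \<open>p\<close>,
  which is the image of \<open>x0\<close>; the other point of \<open>\<phi> (transpose x0 y)\<close> is the image of \<open>y\<close>.\<close>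

lemma ex_sigma:
  obtains \<sigma> where "bij_betw \<sigma> X X"
    "\<And>x y. x \<in> X \<Longrightarrow> y \<in> X \<Longrightarrow> x \<noteq> y \<Longrightarrow> \<phi> (transpose x y) = transpose (\<sigma> x) (\<sigma> y)"
proof -
  obtain x0 where x0: "x0 \<in> X" using ex_fresh[of "{}"] by auto
  obtain x1 where x1: "x1 \<in> X" "x1 \<noteq> x0" using ex_fresh[of "{x0}"] by auto
  obtain x2 where x2: "x2 \<in> X" "x2 \<noteq> x0" "x2 \<noteq> x1" using ex_fresh[of "{x0, x1}"] by auto
  obtain p1 q1 where pq1: "p1 \<in> X" "q1 \<in> X" "p1 \<noteq> q1" "\<phi> (transpose x0 x1) = transpose p1 q1"
    using phi_transpose[OF x0 x1(1)] x1 by metis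
  obtain p2 q2 where pq2: "p2 \<in> X" "q2 \<in> X" "p2 \<noteq> q2" "\<phi> (transpose x0 x2) = transpose p2 q2"
    using phi_transpose[OF x0 x2(1)] x2 by metis
  have ov: "{p1, q1} \<inter> {p2, q2} \<noteq> {}" "{p1, q1} \<noteq> {p2, q2}"
    using phi_transpose_overlap[OF x0 x1(1) x2(1) _ _ _ pq1(3,4) pq2(3,4)] x1 x2 by auto
  from ov(1) obtain p where p: "p \<in> {p1, q1}" "p \<in> {p2, q2}" by blast
  obtain q where q: "{p1, q1} = {p, q}" "q \<noteq> p" using p pq1(3) by auto
  obtain r where r: "{p2, q2} = {p, r}" "r \<noteq> p" using p pq2(3) by auto
  have X: "p \<in> X" "q \<in> X" "r \<in> X" using q(1) r(1) pq1(1,2) pq2(1,2) by (metis insertCI insertE singletonD)+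
  have t1: "\<phi> (transpose x0 x1) = transpose p q"
    using pq1 q transpose_eq_iff_doubleton by metis
  have t2: "\<phi> (transpose x0 x2) = transpose p r"
    using pq2 r transpose_eq_iff_doubleton by metis
  have qr: "q \<noteq> r" using ov q r by auto
  \<comment> \<open>This excludes that the image of a further transposition at \<open>x0\<close> closes the triangle
    \<open>p, q, r\<close> instead of passing through \<open>p\<close>.\<close>
  have t12: "\<phi> (transpose x1 x2) = transpose q r"
  proof -
    have "transpose x1 x2 = transpose x0 x1 \<circ> transpose x0 x2 \<circ> transpose x0 x1"
      using transpose_conj_star x1 x2 by metis
    then have "\<phi> (transpose x1 x2) = transpose p q \<circ> transpose p r \<circ> transpose p q"
      using t1 t2 transpose_mem comp_closed phi_comp x0 x1 x2 by metis
    then show ?thesis using transpose_conj_star q r qr by metis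
  qed
  have "\<exists>s. s \<in> X \<and> s \<noteq> p \<and> \<phi> (transpose x0 y) = transpose p s" if y: "y \<in> X" "y \<noteq> x0" for y
  proof (cases "y = x1 \<or> y = x2")
    case True
    then show ?thesis using t1 t2 q r X by auto
  next
    case False
    obtain u v where uv: "u \<in> X" "v \<in> X" "u \<noteq> v" "\<phi> (transpose x0 y) = transpose u v"
      using phi_transpose[OF x0 y(1)] y by metis
    have o1: "{p, q} \<inter> {u, v} \<noteq> {}"
      using phi_transpose_overlap[OF x0 x1(1) y(1) _ _ _ _ t1 uv(3,4)] q x1 y False by auto
    have o2: "{p, r} \<inter> {u, v} \<noteq> {}"
      using phi_transpose_overlap[OF x0 x2(1) y(1) _ _ _ _ t2 uv(3,4)] r x2 y False by auto
    have "transpose x0 y \<noteq> transpose x1 x2"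
      using transpose_eq_iff_doubleton[of x0 y x1 x2] x1 x2 y by (auto simp: doubleton_eq_iff)
    then have "transpose u v \<noteq> transpose q r"
      using t12 uv(4) phi_eq_iff transpose_mem x0 x1 x2 y by metis
    then have "{u, v} \<noteq> {q, r}" using transpose_eq_iff_doubleton uv(3) qr by metis
    with o1 o2 qr q r have "p \<in> {u, v}" by auto
    then show ?thesis
      using uv by (metis insertE singletonD transpose_commute)
  qed
  then obtain s where s: "\<And>y. y \<in> X \<Longrightarrow> y \<noteq> x0 \<Longrightarrow> s y \<in> X \<and> s y \<noteq> p \<and> \<phi> (transpose x0 y) = transpose p (s y)"
    by metis
  define \<sigma> where "\<sigma> = s(x0 := p)"
  have inj_s: "s y \<noteq> s z" if "y \<in> X" "z \<in> X" "y \<noteq> x0" "z \<noteq> x0" "y \<noteq> z" for y z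
  proof
    assume "s y = s z"
    then have "transpose x0 y = transpose x0 z"
      using s that phi_eq_iff transpose_mem x0 by metis
    then show False using transpose_eq_iff_doubleton[of x0 y x0 z] that by (auto simp: doubleton_eq_iff)
  qed
  have inj: "inj_on \<sigma> X"
    unfolding inj_on_def \<sigma>_def using inj_s s by (metis fun_upd_apply)
  have main: "\<phi> (transpose y z) = transpose (\<sigma> y) (\<sigma> z)" if yz: "y \<in> X" "z \<in> X" "y \<noteq> z" for y z
  proof -
    consider "y = x0" | "z = x0" | "y \<noteq> x0" "z \<noteq> x0" by blast
    then show ?thesis
    proof cases
      case 1 then show ?thesis using s yz by (simp add: \<sigma>_def)
    next
      case 2 then show ?thesis using s yz by (metis \<sigma>_def fun_upd_apply transpose_commute)
    next
      case 3
      have "transpose y z = transpose x0 y \<circ> transpose x0 z \<circ> transpose x0 y"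
        using transpose_conj_star 3 yz by metis
      then have "\<phi> (transpose y z) = transpose p (s y) \<circ> transpose p (s z) \<circ> transpose p (s y)"
        using s 3 transpose_mem comp_closed phi_comp x0 yz by metis
      also have "\<dots> = transpose (s y) (s z)"
        using transpose_conj_star s inj_s 3 yz by metis
      finally show ?thesis using 3 by (simp add: \<sigma>_def)
    qed
  qed
  have into: "\<sigma> ` X \<subseteq> X" using s X by (auto simp: \<sigma>_def)
  have "w \<in> \<sigma> ` X" if w: "w \<in> X" for w
  proof (cases "w = p")
    case True then show ?thesis using x0 by (auto simp: \<sigma>_def)
  next
    case False
    obtain t where t: "t \<in> G" "\<phi> t = transpose p w"
      using phi_surj[OF transpose_mem[OF X(1) w]] by blast
    have "is_transposition_on X t"
      using phi_transposition_iff[OF t(1)] t(2) X(1) w False by (metis is_transposition_on_def)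
    then obtain y z where yz: "y \<in> X" "z \<in> X" "y \<noteq> z" "t = transpose y z"
      by (auto simp: is_transposition_on_def)
    then have "transpose (\<sigma> y) (\<sigma> z) = transpose p w" using main t(2) by metis
    moreover have "\<sigma> y \<noteq> \<sigma> z" using inj yz by (meson inj_onD)
    ultimately have "{\<sigma> y, \<sigma> z} = {p, w}" using transpose_eq_iff_doubleton False by metis
    then show ?thesis using yz by auto
  qed
  then have "bij_betw \<sigma> X X" using inj into by (auto simp: bij_betw_def)
  then show ?thesis using that main by blast
qed

lemma phi_eq_conjugation:
  obtains \<sigma> where "\<sigma> permutes X" "\<And>g. g \<in> G \<Longrightarrow> \<phi> g = \<sigma> \<circ> g \<circ> inv_fun \<sigma>"
proof -
  obtain s where s: "bij_betw s X X"
    "\<And>x y. x \<in> X \<Longrightarrow> y \<in> X \<Longrightarrow> x \<noteq> y \<Longrightarrow> \<phi> (transpose x y) = transpose (s x) (s y)"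
    using ex_sigma by blast
  define \<sigma> where "\<sigma> x = (if x \<in> X then s x else x)" for x
  have "bij_betw \<sigma> X X" using s(1) by (rule bij_betw_cong[THEN iffD1, rotated]) (simp add: \<sigma>_def)
  then have \<sigma>: "\<sigma> permutes X" by (rule bij_imp_permutes) (simp add: \<sigma>_def)
  have \<sigma>t: "\<phi> (transpose x y) = transpose (\<sigma> x) (\<sigma> y)" if "x \<in> X" "y \<in> X" "x \<noteq> y" for x y
    using s(2) that by (simp add: \<sigma>_def)
  have inj\<sigma>: "\<sigma> x = \<sigma> y \<longleftrightarrow> x = y" for x y using permutes_inj[OF \<sigma>] by (simp add: inj_eq)
  have pair: "{\<phi> g (\<sigma> a), \<phi> g (\<sigma> b)} = {\<sigma> (g a), \<sigma> (g b)}"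
    if g: "g \<in> G" and ab: "a \<in> X" "b \<in> X" "a \<noteq> b" for g a b
  proof -
    have gX: "g a \<in> X" "g b \<in> X" using permutes[OF g] ab by (simp_all add: permutes_in_image)
    have ne: "g a \<noteq> g b" using bij[OF g] ab by (metis bij_is_inj injD)
    have "transpose (g a) (g b) = g \<circ> transpose a b \<circ> inv_fun g"
      using conj_transpose[OF bij[OF g]] by simp
    then have "transpose (\<sigma> (g a)) (\<sigma> (g b)) = \<phi> (g \<circ> transpose a b \<circ> inv_fun g)"
      using \<sigma>t[OF gX ne] by simp
    also have "\<dots> = \<phi> g \<circ> transpose (\<sigma> a) (\<sigma> b) \<circ> inv_fun (\<phi> g)"
      using g transpose_mem[OF ab(1,2)] \<sigma>t[OF ab]
      by (simp add: phi_comp comp_closed inv_closed phi_inv)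
    also have "\<dots> = transpose (\<phi> g (\<sigma> a)) (\<phi> g (\<sigma> b))"
      using conj_transpose[OF bij[OF phi_mem[OF g]]] .
    finally have "transpose (\<sigma> (g a)) (\<sigma> (g b)) = transpose (\<phi> g (\<sigma> a)) (\<phi> g (\<sigma> b))" .
    moreover have "\<phi> g (\<sigma> a) \<noteq> \<phi> g (\<sigma> b)"
      using bij[OF phi_mem[OF g]] ab inj\<sigma> by (metis bij_is_inj injD)
    ultimately show ?thesis using transpose_eq_iff_doubleton ne inj\<sigma> by metis
  qed
  \<comment> \<open>The image of a single point is the intersection of the images of two pairs.\<close>
  have in_X: "\<phi> g (\<sigma> a) = \<sigma> (g a)" if g: "g \<in> G" and a: "a \<in> X" for g a
  proof -
    obtain b where b: "b \<in> X" "b \<noteq> a" using ex_fresh[of "{a}"] by auto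
    obtain c where c: "c \<in> X" "c \<noteq> a" "c \<noteq> b" using ex_fresh[of "{a, b}"] by auto
    have ne: "g b \<noteq> g c" "g a \<noteq> g b" using bij[OF g] b c by (metis bij_is_inj injD)+
    have "\<phi> g (\<sigma> a) \<in> {\<sigma> (g a), \<sigma> (g b)}" "\<phi> g (\<sigma> a) \<in> {\<sigma> (g a), \<sigma> (g c)}"
      using pair[OF g a b(1)] pair[OF g a c(1)] b c by auto
    then show ?thesis using ne inj\<sigma> by auto
  qed
  have "\<phi> g \<circ> \<sigma> = \<sigma> \<circ> g" if g: "g \<in> G" for g
  proof
    fix a
    show "(\<phi> g \<circ> \<sigma>) a = (\<sigma> \<circ> g) a"
      using in_X[OF g] permutes[OF g] permutes[OF phi_mem[OF g]] \<sigma>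
      by (cases "a \<in> X") (simp_all add: permutes_not_in)
  qed
  then have "\<phi> g = \<sigma> \<circ> g \<circ> inv_fun \<sigma>" if "g \<in> G" for g
    using that permutes_inv_o(1)[OF \<sigma>] by (metis comp_assoc comp_id)
  then show ?thesis using that \<sigma> by blast
qed

end

section \<open>Cycles of a fixed length\<close>

text \<open>The points of \<open>X\<close> that lie on the cycles of length exactly \<open>k\<close> of \<open>f\<close>, for \<open>k \<ge> 1\<close>.\<close>

definition exact_period :: "'a set \<Rightarrow> nat \<Rightarrow> ('a \<Rightarrow> 'a) \<Rightarrow> 'a set" where
  "exact_period X k f = {x \<in> X. (f ^^ k) x = x \<and> (\<forall>j. 0 < j \<and> j < k \<longrightarrow> (f ^^ j) x \<noteq> x)}"

lemma exact_period_image: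
  assumes h: "h permutes X" and conj: "f' \<circ> h = h \<circ> f"
  shows "exact_period X k f' = h ` exact_period X k f"
proof -
  have pow: "(f' ^^ j) (h x) = h ((f ^^ j) x)" for j x
    by (induction j) (use conj in \<open>simp_all add: fun_eq_iff\<close>)
  have "h x \<in> exact_period X k f' \<longleftrightarrow> x \<in> exact_period X k f" for x
    using permutes_inj[OF h] permutes_in_image[OF h] by (simp add: exact_period_def pow inj_eq)
  then have "h -` exact_period X k f' = exact_period X k f" by auto
  then show ?thesis using surj_image_vimage_eq[OF permutes_surj[OF h]] by metis
qed

lemma exact_period_closed:
  assumes f: "f permutes X"
  shows "f x \<in> exact_period X k f \<longleftrightarrow> x \<in> exact_period X k f"
proof -
  have "(f ^^ j) (f x) = f x \<longleftrightarrow> (f ^^ j) x = x" for j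
    using permutes_inj[OF f] by (metis funpow_swap1 injD)
  then show ?thesis using permutes_in_image[OF f] by (simp add: exact_period_def)
qed

lemma finite_exact_period_diff:
  assumes f: "inj f" and D: "finite {x. f' x \<noteq> f x}"
  shows "finite (exact_period X k f' - exact_period X k f)"
proof (rule finite_subset)
  let ?D = "{x. f' x \<noteq> f x}"
  show "exact_period X k f' - exact_period X k f \<subseteq> (\<Union>j<k. (f ^^ j) -` ?D)"
  proof
    fix x assume x: "x \<in> exact_period X k f' - exact_period X k f"
    show "x \<in> (\<Union>j<k. (f ^^ j) -` ?D)"
    proof (rule ccontr)
      assume "x \<notin> (\<Union>j<k. (f ^^ j) -` ?D)"
      then have eq: "f' ((f ^^ j) x) = f ((f ^^ j) x)" if "j < k" for j using that by auto
      have "(f' ^^ j) x = (f ^^ j) x" if "j \<le> k" for j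
        using that by (induction j) (simp_all add: eq)
      then show False using x by (auto simp: exact_period_def)
    qed
  qed
  show "finite (\<Union>j<k. (f ^^ j) -` ?D)"
    using finite_vimageI[OF D inj_fn[OF f]] by blast
qed

text \<open>Outside the \<open>k\<close>-cycles of \<open>f\<close> there is room for arbitrarily many further \<open>k\<close>-cycles, which a
  finitary permutation creates without touching the existing ones.\<close>

lemma ex_finitary_adding_cycles:
  assumes f: "f permutes X" and k: "k \<ge> 1" and inf: "infinite (X - exact_period X k f)"
  shows "\<exists>a. a permutes X \<and> finite {x. a x \<noteq> x} \<and>
    exact_period X k f \<subseteq> exact_period X k (f \<circ> a) \<and>
    finite (exact_period X k (f \<circ> a) - exact_period X k f) \<and>
    m \<le> card (exact_period X k (f \<circ> a) - exact_period X k f)"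
proof -
  define B where "B = exact_period X k f"
  define C where "C = X - B"
  have fB: "f x \<in> B \<longleftrightarrow> x \<in> B" for x unfolding B_def by (rule exact_period_closed[OF f])
  have fC: "f x \<in> C \<longleftrightarrow> x \<in> C" for x using fB permutes_in_image[OF f] by (simp add: C_def)
  have f_inv: "f (inv_fun f x) = x" for x using permutes_inverses[OF f] by simp
  have inf': "infinite C" using inf by (simp add: C_def B_def)
  obtain e0 :: "nat \<Rightarrow> 'a" where e0: "inj e0" "range e0 \<subseteq> C"
    using infinite_countable_subset[OF inf'] by blast
  define e where "e i j = e0 (prod_encode (i, j))" for i j
  have e_eq: "e i j = e i' j' \<longleftrightarrow> i = i' \<and> j = j'" for i j i' j'
    using e0(1) by (simp add: e_def inj_eq)
  have eC: "e i j \<in> C" for i j using e0(2) by (auto simp: e_def)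
  define I where "I = {..<m} \<times> {..<k}"
  define F where "F = case_prod e ` I"
  have injF: "inj_on (case_prod e) I" by (auto simp: inj_on_def e_eq)
  have finF: "finite F" "card F = m * k"
    using card_image[OF injF] by (simp_all add: F_def I_def card_cartesian_product)
  \<comment> \<open>If \<open>p\<close> agrees with \<open>q\<close> on \<open>F\<close>, then \<open>f \<circ> p\<close> maps \<open>e i j\<close> to \<open>e i (Suc j mod k)\<close>.\<close>
  define q where "q x = (case inv_into I (case_prod e) x of (i, j) \<Rightarrow> inv_fun f (e i (Suc j mod k)))" for x
  have q: "q (e i j) = inv_fun f (e i (Suc j mod k))" if "i < m" "j < k" for i j
    using inv_into_f_f[OF injF, of "(i, j)"] that by (simp add: q_def I_def)
  have injq: "inj_on q F"
  proof (rule inj_onI)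
    fix x y assume "x \<in> F" "y \<in> F" and eq: "q x = q y"
    then obtain i j i' j' where ij: "x = e i j" "y = e i' j'" "i < m" "j < k" "i' < m" "j' < k"
      by (auto simp: F_def I_def)
    then have "e i (Suc j mod k) = e i' (Suc j' mod k)" using eq q f_inv by metis
    then have "i = i'" "Suc j mod k = Suc j' mod k" by (auto simp: e_eq)
    moreover from this(2) have "j = j'" using ij by (auto simp: mod_Suc split: if_splits)
    ultimately show "x = y" using ij by simp
  qed
  have "q ` F \<subseteq> C"
  proof
    fix y assume "y \<in> q ` F"
    then obtain i j where "y = q (e i j)" "i < m" "j < k" by (auto simp: F_def I_def)
    then have "f y \<in> C" using q f_inv eC by metis
    then show "y \<in> C" using fC by simp
  qed
  moreover have "F \<subseteq> C" using eC by (auto simp: F_def)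
  ultimately obtain p where p: "p permutes C" "finite {x. p x \<noteq> x}" "\<And>x. x \<in> F \<Longrightarrow> p x = q x"
    using finite_inj_extends_to_finitary_permutation[OF finF(1) _ _ injq] by metis
  have cyc: "((f \<circ> p) ^^ l) (e i j) = e i ((j + l) mod k)" if ij: "i < m" "j < k" for i j l
  proof (induction l)
    case (Suc l)
    have "(j + l) mod k < k" using k by simp
    moreover from this have "e i ((j + l) mod k) \<in> F" using ij(1) by (force simp: F_def I_def)
    ultimately have "f (p (e i ((j + l) mod k))) = e i (Suc (j + l) mod k)"
      using p(3) q[OF ij(1)] f_inv by (simp add: mod_Suc_eq)
    then show ?case using Suc by simp
  qed (use ij in simp)
  have "F \<subseteq> exact_period X k (f \<circ> p)"
  proof
    fix x assume "x \<in> F"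
    then obtain i j where ij: "x = e i j" "i < m" "j < k" by (auto simp: F_def I_def)
    have "(j + l) mod k \<noteq> j" if l: "0 < l" "l < k" for l
    proof
      assume "(j + l) mod k = j"
      then show False using l ij(3) by (cases "j + l < k") (simp_all add: le_mod_geq)
    qed
    then show "x \<in> exact_period X k (f \<circ> p)"
      unfolding exact_period_def using ij cyc eC[of i j] by (auto simp: e_eq C_def)
  qed
  moreover have B_sub: "B \<subseteq> exact_period X k (f \<circ> p)"
  proof
    fix x assume x: "x \<in> B"
    have inB: "(f ^^ j) x \<in> B" for j by (induction j) (use x fB in simp_all)
    have "((f \<circ> p) ^^ j) x = (f ^^ j) x" for j
      using inB p(1) by (induction j) (simp_all add: permutes_not_in C_def)
    then show "x \<in> exact_period X k (f \<circ> p)" using x by (simp add: B_def exact_period_def)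
  qed
  moreover have fin: "finite (exact_period X k (f \<circ> p) - B)" unfolding B_def
  proof (rule finite_exact_period_diff[OF permutes_inj[OF f]])
    show "finite {x. (f \<circ> p) x \<noteq> f x}"
      by (rule finite_subset[OF _ p(2)]) auto
  qed
  moreover have "F \<inter> B = {}" using eC by (auto simp: F_def C_def)
  ultimately have "card F \<le> card (exact_period X k (f \<circ> p) - B)"
    by (intro card_mono) auto
  moreover have "m \<le> card F" using k by (simp add: finF)
  ultimately have "m \<le> card (exact_period X k (f \<circ> p) - B)" by (rule order_trans[rotated])
  moreover have "p permutes X" using p(1) by (rule permutes_subset) (simp add: C_def)
  ultimately show ?thesis
    using p(2) fin B_sub by (intro exI[of _ p]) (simp add: B_def)
qed

text \<open>The excess of a set over \<open>B\<close> is preserved by permutations, even for an infinite \<open>B\<close> that the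
  permutation does not preserve, provided that the permutation is finitary.\<close>

lemma card_diff_image_eq:
  assumes h: "h permutes X" "h ` A = A'" and B: "B \<subseteq> A" "B \<subseteq> A'"
    and fin: "finite (A - B)" "finite (A' - B)"
    and cases: "finite B \<or> finite {x. h x \<noteq> x}"
  shows "card (A - B) = card (A' - B)"
  using cases
proof
  assume "finite B"
  then show ?thesis
    using h B card_image[OF permutes_inj_on[OF h(1)], of A] by (simp add: card_Diff_subset)
next
  assume S: "finite {x. h x \<noteq> x}"
  define E where "E = (A - B) \<union> (A' - B) \<union> {x. h x \<noteq> x}"
  have fE: "finite E" using fin S by (simp add: E_def)
  have "h permutes E"
    using h(1) by (rule permutes_superset) (auto simp: E_def)
  then have "h ` (A \<inter> E) = A' \<inter> E"
    using image_Int[OF permutes_inj[OF h(1)], of A E] h(2) by (simp add: permutes_image)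
  then have "card (A \<inter> E) = card (A' \<inter> E)"
    using card_image[OF permutes_inj_on[OF h(1)], of "A \<inter> E"] by simp
  moreover have "A - B = (A \<inter> E) - (B \<inter> E)" "A' - B = (A' \<inter> E) - (B \<inter> E)"
    by (auto simp: E_def)
  moreover have "B \<inter> E \<subseteq> A \<inter> E" "B \<inter> E \<subseteq> A' \<inter> E" using B by auto
  ultimately show ?thesis using fE by (simp add: card_Diff_subset)
qed

section \<open>Permutations that normalize Houghton's group\<close>

text \<open>Houghton's group as a set of permutations that fix every point outside the rays, in place of
  the extensional functions.\<close>

definition houghton_perms :: "nat \<Rightarrow> (nat \<times> nat \<Rightarrow> nat \<times> nat) set" where
  "houghton_perms n = {p. p permutes rays n \<and> eventual_translation n p}"

lemma eventual_translation_cong: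
  assumes "\<And>x. x \<in> rays n \<Longrightarrow> f x = g x"
  shows "eventual_translation n f \<longleftrightarrow> eventual_translation n g"
proof -
  have "bij_betw f (rays n) (rays n) \<longleftrightarrow> bij_betw g (rays n) (rays n)"
    using assms by (rule bij_betw_cong)
  then show ?thesis
    unfolding eventual_translation_def using assms by (auto simp: Ball_def)
qed

lemma houghton_permsE:
  assumes "g \<in> houghton_perms n"
  obtains m :: "nat \<Rightarrow> int" and K where "finite K"
    "\<And>x. x \<in> rays n - K \<Longrightarrow> fst (g x) = fst x \<and> int (snd (g x)) = int (snd x) + m (fst x)"
proof -
  obtain m :: "nat \<Rightarrow> int" and K where "finite K"
    "\<forall>(k, p) \<in> rays n - K. fst (g (k, p)) = k \<and> int (snd (g (k, p))) = int p + m k"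
    using assms unfolding houghton_perms_def eventual_translation_def by blast
  then show ?thesis by (intro that[of K m]) (simp_all add: case_prod_beta)
qed

lemma finitary_overgroup_houghton_perms:
  assumes "n \<ge> 1"
  shows "finitary_overgroup (rays n) (houghton_perms n)"
proof
  show "infinite (rays n)"
    unfolding rays_def using assms infinite_Ici[of "1::nat"]
    by (auto dest: finite_cartesian_productD2)
next
  fix g h assume g: "g \<in> houghton_perms n" and h: "h \<in> houghton_perms n"
  have "eventual_translation n (compose (rays n) g h)"
    using g h by (auto simp: houghton_perms_def intro: eventual_translation_compose)
  then have "eventual_translation n (g \<circ> h)"
    by (rule eventual_translation_cong[THEN iffD1, rotated]) (simp add: compose_def)
  then show "g \<circ> h \<in> houghton_perms n"
    using g h by (simp add: houghton_perms_def permutes_compose)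
next
  fix g assume g: "g \<in> houghton_perms n"
  then have gp: "g permutes rays n" by (simp add: houghton_perms_def)
  have inv: "inv_into (rays n) g x = inv_fun g x" if "x \<in> rays n" for x
  proof (rule inv_into_f_eq[OF permutes_inj_on[OF gp]])
    show "inv_fun g x \<in> rays n" using permutes_inv[OF gp] that by (simp add: permutes_in_image)
    show "g (inv_fun g x) = x" using permutes_inverses[OF gp] by simp
  qed
  have "eventual_translation n (\<lambda>x \<in> rays n. inv_into (rays n) g x)"
    using g by (simp add: houghton_perms_def eventual_translation_inv)
  then have "eventual_translation n (inv_fun g)"
    by (rule eventual_translation_cong[THEN iffD1, rotated]) (simp add: inv)
  then show "inv_fun g \<in> houghton_perms n"
    using permutes_inv[OF gp] by (simp add: houghton_perms_def)
next
  fix p assume p: "p permutes rays n" "finite {x. p x \<noteq> x}"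
  have "eventual_translation n p"
    unfolding eventual_translation_def
    using p by (intro conjI permutes_imp_bij exI[of _ "\<lambda>_. 0"] exI[of _ "{x. p x \<noteq> x}"])
      (auto dest: permutes_not_in)
  then show "p \<in> houghton_perms n" using p by (simp add: houghton_perms_def)
qed (simp add: houghton_perms_def)

text \<open>On a single ray, a bijection cannot translate by a nonzero amount near infinity.\<close>

lemma houghton_perms_one_finitary:
  assumes p: "p \<in> houghton_perms 1"
  shows "finite {x. p x \<noteq> x}"
proof -
  from p have perm: "p permutes rays 1" by (simp add: houghton_perms_def)
  obtain m :: "nat \<Rightarrow> int" and K where K: "finite K" and
    tr: "\<And>x. x \<in> rays 1 - K \<Longrightarrow> fst (p x) = fst x \<and> int (snd (p x)) = int (snd x) + m (fst x)"
    by (rule houghton_permsE[OF p]) (rule that)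
  define N where "N = Max (insert (nat \<bar>m 1\<bar>) (snd ` K))"
  have N_ge: "nat \<bar>m 1\<bar> \<le> N" "\<And>x. x \<in> K \<Longrightarrow> snd x \<le> N"
    using K by (auto simp: N_def)
  define L where "L = nat (int N + m 1)"
  have L: "int L = int N + m 1" using N_ge by (simp add: L_def)
  have far: "p (1, q) = (1, nat (int q + m 1))" if "q > N" for q
  proof -
    have "(1, q) \<in> rays 1 - K" using N_ge(2)[of "(1, q)"] that by (auto simp: rays_def)
    from tr[OF this] show ?thesis by (auto intro: prod_eqI)
  qed
  \<comment> \<open>Hence the complements \<open>{1..N}\<close> and \<open>{1..L}\<close> of these tails have the same cardinality,
    that is, \<open>N = N + m 1\<close>.\<close>
  have tail: "p ` ({1} \<times> {N<..}) = {1} \<times> {L<..}"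
  proof (intro equalityI subsetI)
    fix y assume "y \<in> p ` ({1} \<times> {N<..})"
    then show "y \<in> {1} \<times> {L<..}" using far L by (auto simp: nat_less_iff zless_nat_eq_int_zless)
  next
    fix y assume "y \<in> {1::nat} \<times> {L<..}"
    then obtain r where r: "y = (1, r)" "r > L" by auto
    define q where "q = nat (int r - m 1)"
    have q: "int q = int r - m 1" using r L by (simp add: q_def)
    then have "q > N" using r L by linarith
    moreover have "p (1, q) = y" using far[OF \<open>q > N\<close>] q r by simp
    ultimately show "y \<in> p ` ({1} \<times> {N<..})" by (metis SigmaI greaterThan_iff imageI singletonI)
  qed
  have split: "rays 1 - {1} \<times> {M<..} = {1} \<times> {1..M}" for M by (auto simp: rays_def)
  have "p ` (rays 1 - {1} \<times> {N<..}) = rays 1 - {1} \<times> {L<..}"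
    using permutes_image[OF perm] tail by (simp add: image_set_diff[OF permutes_inj[OF perm]])
  then have "p ` ({1} \<times> {1..N}) = {1} \<times> {1..L}" by (simp only: split)
  then have "card ({1::nat} \<times> {1..L}) = card ({1::nat} \<times> {1..N})"
    using card_image[OF permutes_inj_on[OF perm], of "{1} \<times> {1..N}"] by simp
  then have "m 1 = 0" using L by (simp add: card_cartesian_product)
  have "{x. p x \<noteq> x} \<subseteq> K"
  proof
    fix x assume x: "x \<in> {x. p x \<noteq> x}"
    then have "x \<in> rays 1" using perm by (auto dest: permutes_not_in)
    moreover from this have "fst x = 1" by (auto simp: rays_def)
    ultimately show "x \<in> K" using tr[of x] x \<open>m 1 = 0\<close> by (auto intro: prod_eqI)
  qed
  then show ?thesis using K finite_subset by blast
qed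

text \<open>With a second ray \<open>j\<close> available, the translation of ray \<open>i\<close> is completed to a bijection by
  shifting \<open>j\<close> towards its origin and sending \<open>(j, 1)\<close> to \<open>(i, 1)\<close>.\<close>

lemma ex_shift:
  assumes i: "i \<in> {1..n}" and n: "n \<ge> 2"
  shows "\<exists>t \<in> houghton_perms n. \<forall>p \<ge> 1. t (i, p) = (i, Suc p)"
proof -
  obtain j where j: "j \<in> {1..n}" "j \<noteq> i"
    using i n by (metis One_nat_def atLeastAtMost_iff le_refl numeral_2_eq_2 Suc_leD not_less_eq_eq n_not_Suc_n)
  define t where "t = (\<lambda>(k, p). if p = 0 then (k, p) else if k = i then (i, Suc p)
    else if k = j then if p = 1 then (i, 1) else (j, p - 1) else (k, p))"
  define t' where "t' = (\<lambda>(k, p). if p = 0 then (k, p) else if k = j then (j, Suc p)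
    else if k = i then if p = 1 then (j, 1) else (i, p - 1) else (k, p))"
  have "bij_betw t (rays n) (rays n)"
    by (rule bij_betw_byWitness[of _ t']) (use i j in \<open>auto simp: t_def t'_def rays_def split: if_splits\<close>)
  moreover have "t x = x" if "x \<notin> rays n" for x
    using that i j by (cases x) (auto simp: t_def rays_def)
  ultimately have perm: "t permutes rays n" by (rule bij_imp_permutes)
  have "eventual_translation n t"
    unfolding eventual_translation_def
  proof (intro conjI permutes_imp_bij[OF perm] exI[of _ "{(j, 1)}"]
      exI[of _ "\<lambda>k. if k = i then 1 else if k = j then - 1 else 0"])
  qed (use i j in \<open>auto simp: t_def rays_def\<close>)
  then show ?thesis using perm by (intro bexI[of _ t]) (auto simp: t_def houghton_perms_def)
qed

text \<open>Let \<open>t\<close> translate ray \<open>i\<close> by 1. Then \<open>f\<close> carries the points of ray \<open>i\<close> to a forward orbit of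
  the conjugate \<open>s\<close> of \<open>t\<close> by \<open>f\<close>, which is an eventual translation too; such an infinite orbit ends
  up moving outwards on a single ray.\<close>

lemma normalizer_eventually_monotone:
  assumes f: "f permutes rays n"
    and norm: "\<And>t. t \<in> houghton_perms n \<Longrightarrow> f \<circ> t \<circ> inv_fun f \<in> houghton_perms n"
    and i: "i \<in> {1..n}" and n: "n \<ge> 2"
  shows "\<exists>k M. \<forall>p \<ge> M. fst (f (i, p)) = k \<and> snd (f (i, p)) < snd (f (i, Suc p))"
proof -
  obtain t where t: "t \<in> houghton_perms n" "\<And>p. p \<ge> 1 \<Longrightarrow> t (i, p) = (i, Suc p)"
    using ex_shift[OF i n] by blast
  define s where "s = f \<circ> t \<circ> inv_fun f"
  have s: "s (f (i, p)) = f (i, Suc p)" if "p \<ge> 1" for p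
    using t(2)[OF that] permutes_inverses[OF f] by (simp add: s_def)
  have s_mem: "s \<in> houghton_perms n" using norm[OF t(1)] by (simp add: s_def)
  obtain m :: "nat \<Rightarrow> int" and K where K: "finite K" and
    tr: "\<And>x. x \<in> rays n - K \<Longrightarrow> fst (s x) = fst x \<and> int (snd (s x)) = int (snd x) + m (fst x)"
    by (rule houghton_permsE[OF s_mem]) (rule that)
  have inj: "inj (\<lambda>p. f (i, p))" using permutes_inj[OF f] by (auto simp: inj_def)
  have "finite ((\<lambda>p. f (i, p)) -` K)" by (rule finite_vimageI[OF K inj])
  then obtain M0 where "\<forall>p \<in> (\<lambda>p. f (i, p)) -` K. p \<le> M0"
    by (meson finite_nat_set_iff_bounded_le)
  then have M0: "p \<le> M0" if "f (i, p) \<in> K" for p using that by simp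
  define M where "M = Suc M0"
  have step: "fst (f (i, Suc p)) = fst (f (i, p)) \<and>
      int (snd (f (i, Suc p))) = int (snd (f (i, p))) + m (fst (f (i, p)))" if p: "p \<ge> M" for p
  proof -
    have "f (i, p) \<notin> K" using M0[of p] p by (auto simp: M_def)
    moreover have "f (i, p) \<in> rays n"
      using f i p by (simp add: permutes_in_image) (simp add: rays_def M_def)
    ultimately show ?thesis using tr[of "f (i, p)"] s[of p] p by (simp add: M_def)
  qed
  define k where "k = fst (f (i, M))"
  have orbit: "fst (f (i, M + q)) = k \<and> int (snd (f (i, M + q))) = int (snd (f (i, M))) + int q * m k"
    for q
  proof (induction q)
    case (Suc q)
    then show ?case using step[of "M + q"] by (simp add: algebra_simps)
  qed (simp add: k_def)
  have "m k > 0"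
  proof (rule ccontr)
    assume "\<not> m k > 0"
    then consider "m k = 0" | "m k \<le> - 1" by linarith
    then show False
    proof cases
      case 1
      then have "f (i, M + 1) = f (i, M + 0)"
        using orbit[of 1] orbit[of 0] by (auto intro: prod_eqI)
      then show False using inj by (auto dest: injD)
    next
      case 2
      define q where "q = Suc (snd (f (i, M)))"
      have "int q * m k \<le> int q * (- 1)" using 2 by (intro mult_left_mono) auto
      then show False using orbit[of q] by (simp add: q_def)
    qed
  qed
  have "fst (f (i, p)) = k \<and> snd (f (i, p)) < snd (f (i, Suc p))" if p: "p \<ge> M" for p
  proof -
    have "fst (f (i, p)) = k" using orbit[of "p - M"] p by simp
    then show ?thesis using step[OF p] \<open>m k > 0\<close> by simp
  qed
  then show ?thesis by blast
qed

text \<open>If all points of a cycle are far out, then \<open>f\<close> preserves the relation of lying further in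
  on the same ray for points of the cycle. A cycle of more than \<open>n\<close> points has two points on the same
  ray, and iterating the power of \<open>f\<close> that carries the inner one to the outer one gives a
  contradiction. So every cycle of length \<open>n + 1\<close> meets a fixed finite set.\<close>

lemma finite_exact_period_of_monotone:
  assumes f: "f permutes rays n"
    and mono: "\<And>i. i \<in> {1..n} \<Longrightarrow>
      \<exists>k M. \<forall>p \<ge> M. fst (f (i, p)) = k \<and> snd (f (i, p)) < snd (f (i, Suc p))"
  shows "finite (exact_period (rays n) (Suc n) f)"
proof -
  obtain \<kappa> M' where M': "\<And>i p. i \<in> {1..n} \<Longrightarrow> p \<ge> M' i \<Longrightarrow>
      fst (f (i, p)) = \<kappa> i \<and> snd (f (i, p)) < snd (f (i, Suc p))"
    using mono by metis
  define M where "M = (\<Sum>i = 1..n. M' i)"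
  have M_ge: "M' i \<le> M" if "i \<in> {1..n}" for i
    unfolding M_def using that by (intro member_le_sum) auto
  have order: "fst (f y) = fst (f z) \<and> snd (f y) < snd (f z)"
    if yz_rel: "y \<in> rays n" "fst y = fst z" "M \<le> snd y" "snd y < snd z" for y z
  proof -
    obtain i p q where yz: "y = (i, p)" "z = (i, q)" using yz_rel(2) by (metis prod.collapse)
    have i: "i \<in> {1..n}" using yz_rel(1) yz by (simp add: rays_def)
    have p: "M' i \<le> p" "p < q" using yz_rel(3,4) yz M_ge[OF i] by auto
    from p(2) have "snd (f (i, p)) < snd (f (i, q))"
    proof (induction q)
      case (Suc q)
      show ?case
      proof (cases "p = q")
        case True then show ?thesis using M'[OF i p(1)] by simp
      next
        case False
        then have "p < q" using Suc.prems by simp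
        then have "snd (f (i, p)) < snd (f (i, q))" by (rule Suc.IH)
        also have "\<dots> < snd (f (i, Suc q))" using M'[OF i, of q] p(1) \<open>p < q\<close> by simp
        finally show ?thesis .
      qed
    qed simp
    then show ?thesis using M'[OF i, of p] M'[OF i, of q] p yz by simp
  qed
  define K where "K = {1..n} \<times> {..<M}"
  have "exact_period (rays n) (Suc n) f \<subseteq> (\<Union>j<Suc n. (f ^^ j) -` K)"
  proof
    fix x assume x: "x \<in> exact_period (rays n) (Suc n) f"
    show "x \<in> (\<Union>j<Suc n. (f ^^ j) -` K)"
    proof (rule ccontr)
      assume out: "x \<notin> (\<Union>j<Suc n. (f ^^ j) -` K)"
      define orb where "orb j = (f ^^ j) x" for j
      have per: "(f ^^ Suc n) x = x" and
        exact: "\<And>j. 0 < j \<Longrightarrow> j < Suc n \<Longrightarrow> (f ^^ j) x \<noteq> x" and "x \<in> rays n"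
        using x unfolding exact_period_def by blast+
      have orb_mod: "orb (j mod Suc n) = orb j" for j
        unfolding orb_def by (rule funpow_mod_eq[OF per])
      have orb_rays: "orb j \<in> rays n" for j
        by (induction j) (use \<open>x \<in> rays n\<close> f in \<open>simp_all add: orb_def permutes_in_image\<close>)
      have orb_M: "M \<le> snd (orb j)" for j
      proof -
        have "orb (j mod Suc n) \<notin> K" using out by (auto simp: orb_def)
        then show ?thesis using orb_rays[of j] orb_mod[of j] by (cases "orb j") (auto simp: K_def rays_def)
      qed
      have "(\<lambda>j. fst (orb j)) ` {..n} \<subseteq> {1..n}"
        using orb_rays by (force simp: rays_def mem_Times_iff)
      then have "card ((\<lambda>j. fst (orb j)) ` {..n}) \<le> card {1..n}" by (intro card_mono) auto
      then have "\<not> inj_on (\<lambda>j. fst (orb j)) {..n}" by (intro pigeonhole) simp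
      then obtain a b where ab: "a < b" "b \<le> n" "fst (orb a) = fst (orb b)"
        unfolding inj_on_def by (metis atMost_iff nat_neq_iff)
      have "snd (orb a) \<noteq> snd (orb b)"
      proof
        assume "snd (orb a) = snd (orb b)"
        then have "orb a = orb b" using ab by (intro prod_eqI)
        moreover have "orb b = (f ^^ a) ((f ^^ (b - a)) x)"
          using ab funpow_add[of a "b - a" f] by (simp add: orb_def)
        ultimately have "(f ^^ (b - a)) x = x"
          using inj_fn[OF permutes_inj[OF f], of a] by (simp add: orb_def inj_eq)
        then show False using exact[of "b - a"] ab by simp
      qed
      then consider "snd (orb a) < snd (orb b)" | "snd (orb b) < snd (orb a)" by linarith
      \<comment> \<open>If the later point is the inner one, follow the cycle onwards from there.\<close>
      then obtain c d where cd: "fst (orb c) = fst (orb (c + d))" "snd (orb c) < snd (orb (c + d))"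
      proof cases
        case 1 then show ?thesis using that[of a "b - a"] ab by simp
      next
        case 2
        have "orb (Suc n + a) = orb a"
          using orb_mod[of "Suc n + a"] orb_mod[of a] by (metis mod_add_self1)
        then have "orb (b + (Suc n - b + a)) = orb a" using ab by simp
        then show ?thesis using that[of b "Suc n - b + a"] ab 2 by simp
      qed
      have shifted: "fst (orb (c + l)) = fst (orb (c + l + d)) \<and> snd (orb (c + l)) < snd (orb (c + l + d))" for l
      proof (induction l)
        case (Suc l)
        then show ?case
          using order[OF orb_rays[of "c + l"] _ orb_M, of "orb (c + l + d)"] by (simp add: orb_def)
      qed (use cd in simp)
      have "snd (orb c) < snd (orb (c + d * Suc q))" for q
      proof (induction q)
        case (Suc q)
        also have "snd (orb (c + d * Suc q)) < snd (orb (c + d * Suc q + d))" using shifted by simp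
        finally show ?case by (simp add: algebra_simps)
      qed (use cd in simp)
      from this[of n] show False
        using orb_mod[of "c + d * Suc n"] orb_mod[of c] by (metis less_irrefl mod_mult_self1 mult.commute)
    qed
  qed
  moreover have "finite (\<Union>j<Suc n. (f ^^ j) -` K)"
    using finite_vimageI[OF _ inj_fn[OF permutes_inj[OF f]], of K] by (simp add: K_def)
  ultimately show ?thesis by (rule finite_subset)
qed

text \<open>For \<open>n \<ge> 2\<close> the length \<open>n + 1\<close> works. For \<open>n = 1\<close> all group elements are finitary, and one of the
  lengths 1 and 2 works because no point has both exact periods.\<close>

lemma ex_good_period:
  assumes n: "n \<ge> 1" and f: "f permutes rays n"
    and norm: "\<And>t. t \<in> houghton_perms n \<Longrightarrow> f \<circ> t \<circ> inv_fun f \<in> houghton_perms n"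
  shows "\<exists>k \<ge> 1. infinite (rays n - exact_period (rays n) k f) \<and>
    (finite (exact_period (rays n) k f) \<or> (\<forall>h \<in> houghton_perms n. finite {x. h x \<noteq> x}))"
proof -
  interpret finitary_overgroup "rays n" "houghton_perms n"
    by (rule finitary_overgroup_houghton_perms[OF n])
  show ?thesis
  proof (cases "n = 1")
    case True
    have "rays n = (rays n - exact_period (rays n) 1 f) \<union> (rays n - exact_period (rays n) 2 f)"
      by (auto simp: exact_period_def)
    then have "infinite (rays n - exact_period (rays n) 1 f) \<or> infinite (rays n - exact_period (rays n) 2 f)"
      using infinite by (metis finite_UnI)
    then show ?thesis
      using houghton_perms_one_finitary True by (metis le_refl one_le_numeral)
  next
    case False
    then have "n \<ge> 2" using n by simp
    then have "finite (exact_period (rays n) (Suc n) f)"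
      using finite_exact_period_of_monotone[OF f] normalizer_eventually_monotone[OF f norm] by blast
    then show ?thesis using infinite by (intro exI[of _ "Suc n"]) auto
  qed
qed


section \<open>The Reidemeister number of an automorphism of Houghton's group\<close>

text \<open>The permutation of the whole type that extends an extensional function by the identity.\<close>

definition to_perm :: "nat \<Rightarrow> (nat \<times> nat \<Rightarrow> nat \<times> nat) \<Rightarrow> nat \<times> nat \<Rightarrow> nat \<times> nat" where
  "to_perm n g x = (if x \<in> rays n then g x else x)"

lemma to_perm_mem:
  assumes "g \<in> carrier (houghton_group n)"
  shows "to_perm n g \<in> houghton_perms n"
proof -
  have et: "eventual_translation n g" using assms by (simp add: houghton_group_def)
  then have "eventual_translation n (to_perm n g)"
    by (rule eventual_translation_cong[THEN iffD1, rotated]) (simp add: to_perm_def)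
  moreover from this have "to_perm n g permutes rays n"
    by (intro bij_imp_permutes) (simp_all add: eventual_translation_def to_perm_def)
  ultimately show ?thesis by (simp add: houghton_perms_def)
qed

lemma restrict_mem:
  assumes "p \<in> houghton_perms n"
  shows "restrict p (rays n) \<in> carrier (houghton_group n)"
proof -
  have "eventual_translation n p" using assms by (simp add: houghton_perms_def)
  then have "eventual_translation n (restrict p (rays n))"
    by (rule eventual_translation_cong[THEN iffD1, rotated]) simp
  then show ?thesis by (simp add: houghton_group_def)
qed

lemma to_perm_restrict: "p \<in> houghton_perms n \<Longrightarrow> to_perm n (restrict p (rays n)) = p"
  by (auto simp: to_perm_def houghton_perms_def permutes_not_in)

lemma restrict_to_perm: "g \<in> carrier (houghton_group n) \<Longrightarrow> restrict (to_perm n g) (rays n) = g"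
  by (auto simp: to_perm_def houghton_group_def extensional_def fun_eq_iff)

lemma bij_betw_to_perm: "bij_betw (to_perm n) (carrier (houghton_group n)) (houghton_perms n)"
  by (rule bij_betw_byWitness[of _ "\<lambda>p. restrict p (rays n)"])
    (auto simp: to_perm_restrict restrict_to_perm to_perm_mem restrict_mem)

text \<open>The order of the factors is reversed, because the group multiplies from left to right.\<close>

lemma to_perm_mult:
  assumes "g \<in> carrier (houghton_group n)"
  shows "to_perm n (g \<otimes>\<^bsub>houghton_group n\<^esub> h) = to_perm n h \<circ> to_perm n g"
proof
  fix x
  have "g x \<in> rays n" if "x \<in> rays n"
    using assms that by (auto simp: houghton_group_def eventual_translation_def bij_betw_def)
  then show "to_perm n (g \<otimes>\<^bsub>houghton_group n\<^esub> h) x = (to_perm n h \<circ> to_perm n g) x"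
    by (simp add: houghton_group_def to_perm_def compose_def)
qed

text \<open>The last conclusion holds because the automorphism is onto: conjugation by the inverse of \<open>\<sigma>\<close>
  is the inverse automorphism.\<close>

lemma houghton_automorphism_conjugation:
  assumes n: "n \<ge> 1" and \<phi>: "\<phi> \<in> iso (houghton_group n) (houghton_group n)"
  obtains \<sigma> where "\<sigma> permutes rays n"
    "\<And>h. h \<in> carrier (houghton_group n) \<Longrightarrow> to_perm n (\<phi> h) = \<sigma> \<circ> to_perm n h \<circ> inv_fun \<sigma>"
    "\<And>t. t \<in> houghton_perms n \<Longrightarrow> inv_fun \<sigma> \<circ> t \<circ> inv_fun (inv_fun \<sigma>) \<in> houghton_perms n"
proof -
  let ?H = "houghton_group n"
  have hom: "\<phi> (g \<otimes>\<^bsub>?H\<^esub> h) = \<phi> g \<otimes>\<^bsub>?H\<^esub> \<phi> h" if "g \<in> carrier ?H" "h \<in> carrier ?H" for g h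
    using \<phi> that by (simp add: iso_def hom_mult)
  have bij\<phi>: "bij_betw \<phi> (carrier ?H) (carrier ?H)" using \<phi> by (simp add: iso_def)
  define \<psi> where "\<psi> = to_perm n \<circ> \<phi> \<circ> (\<lambda>p. restrict p (rays n))"
  interpret finitary_overgroup "rays n" "houghton_perms n"
    by (rule finitary_overgroup_houghton_perms[OF n])
  interpret finitary_overgroup_auto "rays n" "houghton_perms n" \<psi>
  proof
    have "bij_betw (\<lambda>p. restrict p (rays n)) (houghton_perms n) (carrier ?H)"
      by (rule bij_betw_byWitness[of _ "to_perm n"])
        (auto simp: to_perm_restrict restrict_to_perm to_perm_mem restrict_mem)
    then show "bij_betw \<psi> (houghton_perms n) (houghton_perms n)"
      unfolding \<psi>_def by (rule bij_betw_trans[OF _ bij_betw_trans[OF bij\<phi> bij_betw_to_perm]])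
    fix g h assume g: "g \<in> houghton_perms n" and h: "h \<in> houghton_perms n"
    have "restrict (g \<circ> h) (rays n) = restrict h (rays n) \<otimes>\<^bsub>?H\<^esub> restrict g (rays n)"
      using permutes[OF h] by (auto simp: houghton_group_def compose_def fun_eq_iff permutes_in_image)
    then show "\<psi> (g \<circ> h) = \<psi> g \<circ> \<psi> h"
      using restrict_mem[OF g] restrict_mem[OF h] bij_betwE[OF bij\<phi>]
      by (simp add: \<psi>_def hom to_perm_mult)
  qed
  obtain \<sigma> where \<sigma>: "\<sigma> permutes rays n" "\<And>g. g \<in> houghton_perms n \<Longrightarrow> \<psi> g = \<sigma> \<circ> g \<circ> inv_fun \<sigma>"
    using phi_eq_conjugation by blast
  show ?thesis
  proof (rule that[OF \<sigma>(1)])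
    fix h assume h: "h \<in> carrier ?H"
    then show "to_perm n (\<phi> h) = \<sigma> \<circ> to_perm n h \<circ> inv_fun \<sigma>"
      using \<sigma>(2)[OF to_perm_mem[OF h]] by (simp add: \<psi>_def restrict_to_perm)
  next
    fix t assume "t \<in> houghton_perms n"
    then obtain t' where t': "t' \<in> houghton_perms n" "\<psi> t' = t" using phi_surj by blast
    have "inv_fun \<sigma> \<circ> (\<sigma> \<circ> t' \<circ> inv_fun \<sigma>) \<circ> \<sigma> = t'"
      by (simp add: fun_eq_iff permutes_inverses[OF \<sigma>(1)])
    then have "inv_fun \<sigma> \<circ> t \<circ> inv_fun (inv_fun \<sigma>) = t'"
      using \<sigma>(2)[OF t'(1)] t'(2) by (simp add: permutes_inv_inv[OF \<sigma>(1)])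
    then show "inv_fun \<sigma> \<circ> t \<circ> inv_fun (inv_fun \<sigma>) \<in> houghton_perms n" using t' by simp
  qed
qed

theorem theorem1p1:
  fixes n :: nat
  assumes "n \<ge> 1"
  shows "R_infinity (houghton_group n)"
  unfolding R_infinity_def
proof
  let ?H = "houghton_group n"
  let ?X = "rays n"
  fix \<phi> assume \<phi>: "\<phi> \<in> iso ?H ?H"
  interpret H: group ?H by (rule group_houghton_group)
  interpret finitary_overgroup ?X "houghton_perms n"
    by (rule finitary_overgroup_houghton_perms[OF assms])
  obtain \<sigma> where \<sigma>: "\<sigma> permutes ?X"
    and conj: "\<And>h. h \<in> carrier ?H \<Longrightarrow> to_perm n (\<phi> h) = \<sigma> \<circ> to_perm n h \<circ> inv_fun \<sigma>"
    and norm: "\<And>t. t \<in> houghton_perms n \<Longrightarrow> inv_fun \<sigma> \<circ> t \<circ> inv_fun (inv_fun \<sigma>) \<in> houghton_perms n"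
    using houghton_automorphism_conjugation[OF assms \<phi>] by metis
  define f where "f = inv_fun \<sigma>"
  have f: "f permutes ?X" unfolding f_def by (rule permutes_inv[OF \<sigma>])
  obtain k where k: "k \<ge> 1" and inf: "infinite (?X - exact_period ?X k f)"
    and alt: "finite (exact_period ?X k f) \<or> (\<forall>h \<in> houghton_perms n. finite {x. h x \<noteq> x})"
    using ex_good_period[OF assms f] norm by (auto simp: f_def)
  define B where "B = exact_period ?X k f"
  have "\<exists>a. \<forall>m. a m permutes ?X \<and> finite {x. a m x \<noteq> x} \<and> B \<subseteq> exact_period ?X k (f \<circ> a m) \<and>
      finite (exact_period ?X k (f \<circ> a m) - B) \<and> m \<le> card (exact_period ?X k (f \<circ> a m) - B)"
    unfolding B_def by (intro choice allI ex_finitary_adding_cycles[OF f k inf])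
  then obtain a where a: "a m permutes ?X" "finite {x. a m x \<noteq> x}"
    "B \<subseteq> exact_period ?X k (f \<circ> a m)" "finite (exact_period ?X k (f \<circ> a m) - B)"
    "m \<le> card (exact_period ?X k (f \<circ> a m) - B)" for m
    by blast
  define v where "v m = card (exact_period ?X k (f \<circ> a m) - B)" for m
  define \<alpha> where "\<alpha> m = restrict (a m) ?X" for m
  have a_mem: "a m \<in> houghton_perms n" for m by (rule finitary_mem[OF a(1,2)])
  have \<alpha>: "\<alpha> m \<in> carrier ?H" "to_perm n (\<alpha> m) = a m" for m
    unfolding \<alpha>_def by (rule restrict_mem[OF a_mem], rule to_perm_restrict[OF a_mem])
  have hom: "\<phi> \<in> hom ?H ?H" using \<phi> by (simp add: iso_def)
  \<comment> \<open>The number of additional \<open>k\<close>-cycle points is an invariant of the twisted conjugacy class.\<close>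
  have v_eq: "v m = v m'" if tw: "(\<alpha> m, \<alpha> m') \<in> twisted_conj ?H \<phi>" for m m'
  proof -
    obtain h where h: "h \<in> carrier ?H" "\<alpha> m' = h \<otimes>\<^bsub>?H\<^esub> \<alpha> m \<otimes>\<^bsub>?H\<^esub> inv\<^bsub>?H\<^esub> (\<phi> h)"
      using tw unfolding twisted_conj_def by blast
    have \<phi>h: "\<phi> h \<in> carrier ?H" using hom h(1) by (rule hom_in_carrier)
    have "\<alpha> m' \<otimes>\<^bsub>?H\<^esub> \<phi> h = h \<otimes>\<^bsub>?H\<^esub> \<alpha> m"
      using h \<alpha>(1) \<phi>h by (simp add: H.m_assoc)
    then have *: "to_perm n (\<phi> h) \<circ> a m' = a m \<circ> to_perm n h"
      using to_perm_mult[OF \<alpha>(1)[of m'], of "\<phi> h"] to_perm_mult[OF h(1), of "\<alpha> m"] \<alpha>(2) by simp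
    have eq: "\<sigma> (to_perm n h (f (a m' x))) = a m (to_perm n h x)" for x
      using fun_cong[OF *, of x] by (simp add: conj[OF h(1)] f_def)
    have "(f \<circ> a m) \<circ> to_perm n h = to_perm n h \<circ> (f \<circ> a m')"
    proof
      fix x
      have "f (a m (to_perm n h x)) = to_perm n h (f (a m' x))"
        using permutes_inverses(2)[OF \<sigma>] by (simp add: f_def flip: eq)
      then show "((f \<circ> a m) \<circ> to_perm n h) x = (to_perm n h \<circ> (f \<circ> a m')) x" by simp
    qed
    then have img: "to_perm n h ` exact_period ?X k (f \<circ> a m') = exact_period ?X k (f \<circ> a m)"
      by (rule exact_period_image[OF permutes[OF to_perm_mem[OF h(1)]], symmetric])
    have "finite B \<or> finite {x. to_perm n h x \<noteq> x}"
      using alt to_perm_mem[OF h(1)] by (auto simp: B_def)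
    then show ?thesis
      unfolding v_def
      by (rule card_diff_image_eq[OF permutes[OF to_perm_mem[OF h(1)]] img a(3) a(3) a(4) a(4), symmetric])
  qed
  have "infinite (reidemeister_classes ?H \<phi>)"
  proof
    assume fin: "finite (reidemeister_classes ?H \<phi>)"
    let ?c = "\<lambda>m. twisted_conj ?H \<phi> `` {\<alpha> m}"
    have "range ?c \<subseteq> reidemeister_classes ?H \<phi>"
      using \<alpha>(1) by (auto simp: reidemeister_classes_def intro: quotientI)
    then have "finite (range ?c)" using fin finite_subset by blast
    then obtain m0 where m0: "infinite {m \<in> UNIV. ?c m = ?c m0}"
      using pigeonhole_infinite[of UNIV ?c] by auto
    have "{m \<in> UNIV. ?c m = ?c m0} \<subseteq> {..v m0}"
    proof
      fix m assume "m \<in> {m \<in> UNIV. ?c m = ?c m0}"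
      then have "(\<alpha> m, \<alpha> m0) \<in> twisted_conj ?H \<phi>"
        using eq_equiv_class[OF _ equiv_twisted_conj[OF group_houghton_group hom] \<alpha>(1)] by auto
      then show "m \<in> {..v m0}" using v_eq a(5)[of m] by (auto simp: v_def)
    qed
    then show False using m0 finite_subset by blast
  qed
  then show "reidemeister_number ?H \<phi> = \<infinity>" by (simp add: reidemeister_number_def)
qed

end
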